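(* Let $k=2K+1\geq5$ be an odd integer and $i$ an integer with $0\le i\le k-2$. Define $$F_k^{(i)}(x,y)=\sum_{s=1}^{K-1}\left(\frac{-2}{2s-1}\sum_{n=0}^{k-2s}\binom{i}{k-2s-n}\binom{n+2s-2}{n}B_n\right)x^{2K-2s}y^{2s-1},$$ $$G_k^{(i)}(x,y)=\sum_{s=1}^{K-1}\left(\frac{2}{2s-1}\sum_{n=0}^{k-2s}\binom{k-2-i}{k-2s-n}\binom{n+2s-2}{n}B_n\right)x^{2K-2s}y^{2s-1},$$ $$R_k^{(i)}(x,y)=-\frac{k-2-2i}{k-2}x^{k-2}+(-1)^ix^{k-2-i}y^i+(-1)^ix^iy^{k-2-i}-\frac{k-2-2i}{k-2}y^{k-2}.$$ Then $$F_k^{(i)}(x+y,x)+F_k^{(i)}(x+y,y)=R_k^{(i)}(x,y)\quad\text{and}\quad G_k^{(i)}(x+y,x)+G_k^{(i)}(x+y,y)=R_k^{(i)}(x,y).$$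
   Context: $B_n$ is the $n$th Bernoulli number, defined by $\frac{t}{e^t-1}=\sum_{n\ge0}B_n\frac{t^n}{n!}$ (so $B_1=-\tfrac12$). Binomial coefficients $\binom{a}{m}$ with $a\ge0$ are the usual ones, equal to $0$ when $m<0$ or $m>a$. All identities are identities of polynomials in $x,y$ with rational coefficients. *)

theory Defs
  imports "HOL-Computational_Algebra.Computational_Algebra"
begin

text \<open>The quotient is taken in the ring of formal power series; the lemma below shows that it is
  exact, although \<open>fps_exp 1 - 1\<close> has no multiplicative inverse.\<close>

definition bernoulli :: "nat \<Rightarrow> rat" where
  "bernoulli n = fact n * fps_nth (fps_X / (fps_exp 1 - 1)) n"

lemma bernoulli_fps:
  "Abs_fps (\<lambda>n. bernoulli n / fact n) * (fps_exp 1 - 1) = fps_X"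
proof -
  have ne: "fps_exp (1::rat) - 1 \<noteq> 0"
  proof
    assume "fps_exp (1::rat) - 1 = 0"
    then have "fps_nth (fps_exp (1::rat) - 1) 1 = 0" by simp
    then show False by simp
  qed
  have "subdegree (fps_exp (1::rat) - 1) = 1"
    by (rule subdegreeI) auto
  then have "(fps_exp (1::rat) - 1) dvd fps_X"
    using ne by (simp add: fps_dvd_iff)
  moreover have "Abs_fps (\<lambda>n. bernoulli n / fact n) = fps_X / (fps_exp 1 - 1)"
    by (simp add: fps_eq_iff bernoulli_def)
  ultimately show ?thesis by simp
qed

text \<open>\<open>\<rat>[x,y]\<close> is represented by \<open>rat poly poly\<close>: the inner variable is \<open>x\<close>, the outer one \<open>y\<close>.\<close>

abbreviation Const :: "rat \<Rightarrow> rat poly poly" where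
  "Const c \<equiv> [:[:c:]:]"

abbreviation X :: "rat poly poly" where
  "X \<equiv> [:[:0, 1:]:]"

abbreviation Y :: "rat poly poly" where
  "Y \<equiv> [:0, 1:]"

text \<open>For \<open>k = 2 * K + 1\<close> the bound \<open>K - 1\<close> is \<open>(k - 1) div 2 - 1\<close> and the exponent \<open>2 * K - 2 * s\<close>
  is \<open>k - 1 - 2 * s\<close>. No natural-number subtraction below truncates
  when \<open>k \<ge> 5\<close> is odd and \<open>i \<le> k - 2\<close>. The arguments \<open>x\<close>, \<open>y\<close> are arbitrary elements of
  \<open>\<rat>[x,y]\<close>, so that substitutions such as \<open>F(x + y, x)\<close> are plain applications.\<close>

definition F :: "nat \<Rightarrow> nat \<Rightarrow> rat poly poly \<Rightarrow> rat poly poly \<Rightarrow> rat poly poly" where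
  "F k i x y = (\<Sum>s = 1..(k - 1) div 2 - 1.
     Const (- 2 / of_nat (2 * s - 1) *
       (\<Sum>n = 0..k - 2 * s. of_nat (i choose (k - 2 * s - n)) *
          of_nat ((n + 2 * s - 2) choose n) * bernoulli n)) *
     x ^ (k - 1 - 2 * s) * y ^ (2 * s - 1))"

definition G :: "nat \<Rightarrow> nat \<Rightarrow> rat poly poly \<Rightarrow> rat poly poly \<Rightarrow> rat poly poly" where
  "G k i x y = (\<Sum>s = 1..(k - 1) div 2 - 1.
     Const (2 / of_nat (2 * s - 1) *
       (\<Sum>n = 0..k - 2 * s. of_nat ((k - 2 - i) choose (k - 2 * s - n)) *
          of_nat ((n + 2 * s - 2) choose n) * bernoulli n)) *
     x ^ (k - 1 - 2 * s) * y ^ (2 * s - 1))"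

definition R :: "nat \<Rightarrow> nat \<Rightarrow> rat poly poly \<Rightarrow> rat poly poly \<Rightarrow> rat poly poly" where
  "R k i x y =
     - Const ((of_nat k - 2 - 2 * of_nat i) / (of_nat k - 2)) * x ^ (k - 2)
     + (- 1) ^ i * x ^ (k - 2 - i) * y ^ i
     + (- 1) ^ i * x ^ i * y ^ (k - 2 - i)
     - Const ((of_nat k - 2 - 2 * of_nat i) / (of_nat k - 2)) * y ^ (k - 2)"

end

theory Submission
  imports Defs
begin

text \<open>
  Put \<open>w = k - 2\<close>. Since \<open>(n + j - 1 choose n) / j = (n + j choose j) / (n + j)\<close>, the sum defining
  \<open>F(x, y)\<close>, extended to \<open>s = K\<close>, satisfies \<open>x F(x, y) = P(x, - y) - P(x, y)\<close>, where
  \<open>P(x, y) = (\<Sum>m. (i choose w + 1 - m) / m \<cdot> x ^ (w + 1 - m) \<cdot> B\<^sub>m(x, y))\<close> and \<open>B\<^sub>m(x, y)\<close> is the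
  homogenised Bernoulli polynomial. The difference equation
  \<open>B\<^sub>m(x, y + x) - B\<^sub>m(x, y) = m x y ^ (m - 1)\<close> and the binomial theorem give
  \<open>P(x, y + x) - P(x, y) = x y ^ (w - i) (x + y) ^ i\<close>. Replacing \<open>x\<close> by \<open>x + y\<close> turns the four values
  of \<open>P\<close> into two such differences, whose sum is the middle part of \<open>R\<close>; the term \<open>s = K\<close> accounts
  for its outer part. The claim for \<open>G\<close> follows by replacing \<open>i\<close> with \<open>w - i\<close>, which negates \<open>R\<close>.
\<close>

section \<open>Recurrences for the Bernoulli numbers\<close>

lemma sum_binomial_bernoulli_less:
  "(\<Sum>j<n. of_nat (n choose j) * bernoulli j) = (if n = 1 then 1 else 0)"
proof -
  have "(\<Sum>j<n. of_nat (n choose j) * bernoulli j) =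
      fact n * (\<Sum>j<n. bernoulli j / fact j * (1 / fact (n - j)))"
    unfolding sum_distrib_left
    by (rule sum.cong) (auto simp: binomial_fact)
  \<comment> \<open>The constant term of \<open>fps_exp 1 - 1\<close> is 0, so the index
    \<open>j = n\<close> may be added; this completes the convolution.\<close>
  also have "(\<Sum>j<n. bernoulli j / fact j * (1 / fact (n - j))) =
      (\<Sum>j = 0..n. bernoulli j / fact j * fps_nth (fps_exp 1 - 1) (n - j))"
    by (rule sum.mono_neutral_cong_left) auto
  also have "\<dots> = fps_nth (Abs_fps (\<lambda>n. bernoulli n / fact n) * (fps_exp 1 - 1)) n"
    by (simp add: fps_mult_nth)
  also have "\<dots> = (if n = 1 then 1 else 0)"
    by (simp only: bernoulli_fps fps_X_nth)
  finally show ?thesis by simp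
qed

text \<open>Classically, \<open>B_n(1) = B_n(0)\<close> except at \<open>n = 1\<close>. That
  exception produces the right-hand side of \<open>bernpoly_diff\<close>.\<close>

lemma sum_binomial_bernoulli:
  "(\<Sum>j\<le>n. of_nat (n choose j) * bernoulli j) = bernoulli n + (if n = 1 then 1 else 0)"
  by (simp add: sum_binomial_bernoulli_less flip: lessThan_Suc_atMost)

lemma bernoulli_0: "bernoulli 0 = 1"
  using sum_binomial_bernoulli_less[of 1] by simp

lemma bernoulli_1: "bernoulli 1 = - 1 / 2"
  using sum_binomial_bernoulli_less[of 2] by (simp add: bernoulli_0 numeral_2_eq_2)

section \<open>Homogenised Bernoulli polynomials and their difference equation\<close>

text \<open>A constant of its own, so that coefficients remain separate factors instead of being
  multiplied into nested polynomials.\<close>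

definition scalar :: "rat \<Rightarrow> rat poly poly" where
  "scalar c = Const c"

lemma scalar_add: "scalar (a + b) = scalar a + scalar b"
  by (simp add: scalar_def)

lemma scalar_mult: "scalar (a * b) = scalar a * scalar b"
  by (simp add: scalar_def)

lemma scalar_minus: "scalar (- a) = - scalar a"
  by (simp add: scalar_def)

lemma scalar_0 [simp]: "scalar 0 = 0"
  by (simp add: scalar_def)

lemma scalar_1 [simp]: "scalar 1 = 1"
  by (simp add: scalar_def one_pCons)

lemma scalar_of_nat: "scalar (of_nat n) = of_nat n"
  by (simp add: scalar_def of_nat_poly)

lemma scalar_sum: "scalar (sum f A) = (\<Sum>a\<in>A. scalar (f a))"
  by (induction A rule: infinite_finite_induct) (auto simp: scalar_add)

text \<open>\<open>B_m(x, y)\<close> of the overview: formally \<open>x ^ m\<close> times the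
  Bernoulli polynomial \<open>B_m\<close> at \<open>y / x\<close>.\<close>

definition bernpoly :: "nat \<Rightarrow> rat poly poly \<Rightarrow> rat poly poly \<Rightarrow> rat poly poly" where
  "bernpoly m x y =
     (\<Sum>j\<le>m. scalar (of_nat (m choose j) * bernoulli (m - j)) * x ^ (m - j) * y ^ j)"

text \<open>Expand \<open>(y + x) ^ j\<close> and collect the powers \<open>y ^ l\<close>. The inner
  sum is the Bernoulli recurrence of order \<open>m - l\<close>; it returns
  \<open>bernoulli (m - l)\<close>, with an extra 1 only at \<open>l = m - 1\<close>. For
  \<open>m = 0\<close> the factor \<open>of_nat m\<close> makes the truncated exponent
  harmless.\<close>

lemma bernpoly_diff:
  "bernpoly m x (y + x) - bernpoly m x y = of_nat m * x * y ^ (m - 1)"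
proof -
  \<comment> \<open>Trinomial revision, with the last lower index reflected so that
    \<open>r = m - j\<close> becomes the Bernoulli index.\<close>
  have choose: "(m choose j) * (j choose l) = (m choose l) * ((m - l) choose (m - j))"
    if "l \<le> j" "j \<le> m" for j l
    using that choose_mult[OF that] binomial_symmetric[of "j - l" "m - l"] by simp
  have "bernpoly m x (y + x) =
      (\<Sum>j\<le>m. \<Sum>l\<le>j. scalar (of_nat ((m choose j) * (j choose l)) * bernoulli (m - j)) *
        x ^ (m - l) * y ^ l)"
    unfolding bernpoly_def binomial_ring sum_distrib_left
    by (intro sum.cong refl)
      (simp add: scalar_mult scalar_of_nat algebra_simps flip: power_add)
  also have "\<dots> = (\<Sum>l\<le>m. \<Sum>r\<le>m - l.
      scalar (of_nat ((m choose l) * ((m - l) choose r)) * bernoulli r) * x ^ (m - l) * y ^ l)"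
    unfolding sum.Sigma[OF finite_atMost ballI[OF finite_atMost]]
    by (rule sum.reindex_bij_witness[where i = "\<lambda>(l, r). (m - r, l)" and j = "\<lambda>(j, l). (l, m - j)"])
      (auto simp: choose simp del: of_nat_mult)
  also have "\<dots> = (\<Sum>l\<le>m. scalar (of_nat (m choose l) *
      (bernoulli (m - l) + (if m - l = 1 then 1 else 0))) * x ^ (m - l) * y ^ l)"
    unfolding sum_binomial_bernoulli[symmetric]
    by (simp add: scalar_sum sum_distrib_left sum_distrib_right mult.assoc)
  also have "\<dots> = bernpoly m x y +
      (\<Sum>l\<le>m. if m - l = 1 then of_nat (m choose l) * x ^ (m - l) * y ^ l else 0)"
    unfolding bernpoly_def sum.distrib[symmetric]
    by (intro sum.cong refl) (auto simp: scalar_add scalar_mult scalar_of_nat algebra_simps)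
  also have "(\<Sum>l\<le>m. if m - l = 1 then of_nat (m choose l) * x ^ (m - l) * y ^ l else 0) =
      of_nat m * x * y ^ (m - 1)"
  proof (cases m)
    case (Suc m')
    have "(\<Sum>l\<le>m. if m - l = 1 then of_nat (m choose l) * x ^ (m - l) * y ^ l else 0) =
        (\<Sum>l\<le>m. if l = m' then of_nat (m choose l) * x ^ (m - l) * y ^ l else 0)"
      using Suc by (intro sum.cong) auto
    then show ?thesis using Suc by simp
  qed simp
  finally show ?thesis by simp
qed

text \<open>\<open>P\<close> of the overview, with \<open>w\<close> and \<open>i\<close> made
  explicit.\<close>

definition bernsum :: "nat \<Rightarrow> nat \<Rightarrow> rat poly poly \<Rightarrow> rat poly poly \<Rightarrow> rat poly poly" where
  "bernsum w i x y =
     (\<Sum>m = 1..Suc w. scalar (of_nat (i choose (Suc w - m)) / of_nat m) * x ^ (Suc w - m) * bernpoly m x y)"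

lemma bernsum_diff:
  assumes "i \<le> w"
  shows "bernsum w i x (y + x) - bernsum w i x y = x * y ^ (w - i) * (x + y) ^ i"
proof -
  have scal: "scalar (a / of_nat m) * of_nat m = scalar a" if "m \<ge> 1" for a m
  proof -
    have "scalar (a / of_nat m) * of_nat m = scalar (a / of_nat m * of_nat m)"
      by (simp only: scalar_mult scalar_of_nat)
    then show ?thesis using that by simp
  qed
  have "bernsum w i x (y + x) - bernsum w i x y =
      (\<Sum>m = 1..Suc w. of_nat (i choose (Suc w - m)) * x ^ (Suc w - m) * x * y ^ (m - 1))"
    unfolding bernsum_def sum_subtractf[symmetric] right_diff_distrib[symmetric] bernpoly_diff
  proof (intro sum.cong refl)
    fix m assume "m \<in> {1..Suc w}"
    then have e: "scalar (of_nat (i choose (Suc w - m)) / of_nat m) * of_nat m = of_nat (i choose (Suc w - m))"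
      by (simp add: scal scalar_of_nat)
    show "scalar (of_nat (i choose (Suc w - m)) / of_nat m) * x ^ (Suc w - m) *
        (of_nat m * x * y ^ (m - 1)) = of_nat (i choose (Suc w - m)) * x ^ (Suc w - m) * x * y ^ (m - 1)"
      by (simp only: e[symmetric] mult_ac)
  qed
  also have "\<dots> = (\<Sum>j\<le>w. of_nat (i choose j) * x ^ j * x * y ^ (w - j))"
    by (rule sum.reindex_bij_witness[where i = "\<lambda>j. Suc w - j" and j = "\<lambda>m. Suc w - m"]) auto
  \<comment> \<open>The binomials vanish for \<open>j > i\<close>, and \<open>i \<le> w\<close>
    allows \<open>y ^ (w - i)\<close> to be split off.\<close>
  also have "\<dots> = (\<Sum>j\<le>i. x * y ^ (w - i) * (of_nat (i choose j) * x ^ j * y ^ (i - j)))"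
    using assms
    by (intro sum.mono_neutral_cong_right) (auto simp: mult_ac simp flip: power_add)
  finally show ?thesis
    by (simp add: binomial_ring sum_distrib_left)
qed

section \<open>The coefficients of \<open>F\<close> as odd parts of \<open>bernsum\<close>\<close>

text \<open>Absorption followed by symmetry. With \<open>j = 2 * s - 1\<close> it trades the weight
  \<open>1 / m\<close> in \<open>bernsum\<close> for the weight \<open>1 / (2 * s - 1)\<close> in
  \<open>F\<close>.\<close>

lemma binomial_div_add:
  assumes "j \<ge> 1"
  shows "of_nat ((n + j) choose j) / of_nat (n + j) = (of_nat ((n + j - 1) choose n) / of_nat j :: rat)"
proof -
  obtain j' where j: "j = Suc j'" using assms by (cases j) auto
  have "Suc j' * (Suc (n + j') choose Suc j') = Suc (n + j') * ((n + j') choose j')"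
    by (rule Suc_times_binomial)
  then have "(of_nat (Suc j') * of_nat (Suc (n + j') choose Suc j') :: rat) =
      of_nat (Suc (n + j')) * of_nat ((n + j') choose j')"
    by (metis of_nat_mult)
  moreover have "(n + j') choose j' = (n + j') choose n"
    using binomial_symmetric[of n "n + j'"] by simp
  ultimately show ?thesis
    unfolding j by (simp add: field_simps del: of_nat_Suc)
qed

text \<open>Named separately so that it can also be evaluated at \<open>s = K\<close>, which the sum
  in \<open>F\<close> omits.\<close>

definition Fcoeff :: "nat \<Rightarrow> nat \<Rightarrow> nat \<Rightarrow> rat" where
  "Fcoeff k i s = - 2 / of_nat (2 * s - 1) *
     (\<Sum>n = 0..k - 2 * s. of_nat (i choose (k - 2 * s - n)) *
        of_nat ((n + 2 * s - 2) choose n) * bernoulli n)"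

text \<open>Even powers of \<open>y\<close> cancel and odd ones contribute
  \<open>- 2 * y ^ j\<close>. Collecting by \<open>j = 2 * s - 1\<close> and setting
  \<open>m = n + j\<close> turns the coefficients into those of \<open>F\<close>.\<close>

lemma bernsum_odd_part:
  assumes "Suc w = 2 * K"
  shows "bernsum w i x (- y) - bernsum w i x y =
    x * (\<Sum>s = 1..K. scalar (Fcoeff (2 * K + 1) i s) * x ^ (2 * K - 2 * s) * y ^ (2 * s - 1))"
proof -
  define A where "A m j = of_nat (i choose (2 * K - m)) / of_nat m * of_nat (m choose j) * bernoulli (m - j)" for m j
  define D where "D j = (- y) ^ j - y ^ j" for j
  have inner: "(\<Sum>m = j..2 * K. A m j) =
      (\<Sum>n = 0..2 * K - j. of_nat (i choose (2 * K - j - n)) *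
        of_nat ((n + j - 1) choose n) * bernoulli n) / of_nat j" if "1 \<le> j" "j \<le> 2 * K" for j
  proof -
    have "(\<Sum>m = j..2 * K. A m j) = (\<Sum>n = 0..2 * K - j. A (n + j) j)"
      using that by (intro sum.reindex_bij_witness[where i = "\<lambda>n. n + j" and j = "\<lambda>m. m - j"]) auto
    also have "\<dots> = (\<Sum>n = 0..2 * K - j. of_nat (i choose (2 * K - j - n)) *
        (of_nat ((n + j - 1) choose n) / of_nat j) * bernoulli n)"
      unfolding binomial_div_add[OF that(1), symmetric] A_def
      by (intro sum.cong refl) (simp add: add.commute)
    finally show ?thesis by (simp add: sum_divide_distrib)
  qed
  have "bernsum w i x (- y) - bernsum w i x y =
      (\<Sum>m = 1..2 * K. \<Sum>j\<le>m. scalar (A m j) * x ^ (2 * K - j) * D j)"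
    unfolding bernsum_def bernpoly_def sum_subtractf[symmetric] right_diff_distrib[symmetric]
      sum_distrib_left assms
  proof (intro sum.cong refl)
    fix m j assume "m \<in> {1..2 * K}" "j \<in> {..m}"
    then have "x ^ (2 * K - j) = x ^ (2 * K - m) * x ^ (m - j)"
      by (simp flip: power_add)
    then show "scalar (of_nat (i choose (2 * K - m)) / of_nat m) * x ^ (2 * K - m) *
        (scalar (of_nat (m choose j) * bernoulli (m - j)) * x ^ (m - j) * ((- y) ^ j - y ^ j)) =
        scalar (A m j) * x ^ (2 * K - j) * D j"
      by (simp only: A_def D_def scalar_mult mult_ac)
  qed
  \<comment> \<open>\<open>D 0 = 0\<close>, so \<open>j = 0\<close> drops out and
    \<open>inner\<close>, which divides by \<open>j\<close>, applies to all remaining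
    indices.\<close>
  also have "\<dots> = (\<Sum>m = 1..2 * K. \<Sum>j\<in>{1..m}. scalar (A m j) * x ^ (2 * K - j) * D j)"
    by (intro sum.cong refl sum.mono_neutral_right) (auto simp: D_def not_le)
  also have "\<dots> = (\<Sum>j = 1..2 * K. \<Sum>m\<in>{j..2 * K}. scalar (A m j) * x ^ (2 * K - j) * D j)"
    unfolding sum.Sigma[OF finite_atLeastAtMost ballI[OF finite_atLeastAtMost]]
    by (rule sum.reindex_bij_witness[where i = "\<lambda>(j, m). (m, j)" and j = "\<lambda>(m, j). (j, m)"]) auto
  also have "\<dots> = (\<Sum>j = 1..2 * K. scalar (\<Sum>m\<in>{j..2 * K}. A m j) * x ^ (2 * K - j) * D j)"
    by (simp add: scalar_sum sum_distrib_right)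
  also have "\<dots> = (\<Sum>j\<in>{j\<in>{1..2 * K}. odd j}. scalar (\<Sum>m\<in>{j..2 * K}. A m j) * x ^ (2 * K - j) * D j)"
    by (intro sum.mono_neutral_right) (auto simp: D_def)
  also have "\<dots> = (\<Sum>s = 1..K. scalar (\<Sum>m\<in>{2 * s - 1..2 * K}. A m (2 * s - 1)) *
      x ^ (2 * K - (2 * s - 1)) * D (2 * s - 1))"
    by (rule sum.reindex_bij_witness[where i = "\<lambda>s. 2 * s - 1" and j = "\<lambda>j. Suc j div 2"])
      (auto elim!: oddE)
  also have "\<dots> = (\<Sum>s = 1..K. x *
      (scalar (Fcoeff (2 * K + 1) i s) * x ^ (2 * K - 2 * s) * y ^ (2 * s - 1)))"
  proof (intro sum.cong refl)
    fix s assume s: "s \<in> {1..K}"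
    have e: "2 * K - (2 * s - 1) = 2 * K + 1 - 2 * s" "n + (2 * s - 1) - 1 = n + 2 * s - 2" for n
      using s by auto
    have "Fcoeff (2 * K + 1) i s = - 2 * (\<Sum>m\<in>{2 * s - 1..2 * K}. A m (2 * s - 1))"
      using s by (subst inner) (auto simp: Fcoeff_def e numeral_2_eq_2)
    then have "scalar (Fcoeff (2 * K + 1) i s) = - 2 * scalar (\<Sum>m\<in>{2 * s - 1..2 * K}. A m (2 * s - 1))"
      by (simp add: scalar_mult scalar_minus scalar_of_nat[of 2, simplified])
    moreover have "D (2 * s - 1) = - 2 * y ^ (2 * s - 1)"
      using s by (simp add: D_def)
    \<comment> \<open>The exponent exceeds \<open>2 * K - 2 * s\<close> by one, which supplies the
      outer factor \<open>x\<close>.\<close>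
    moreover have "x ^ (2 * K - (2 * s - 1)) = x * x ^ (2 * K - 2 * s)"
      using s by (simp add: e Suc_diff_le)
    ultimately show "scalar (\<Sum>m\<in>{2 * s - 1..2 * K}. A m (2 * s - 1)) *
        x ^ (2 * K - (2 * s - 1)) * D (2 * s - 1) =
        x * (scalar (Fcoeff (2 * K + 1) i s) * x ^ (2 * K - 2 * s) * y ^ (2 * s - 1))"
      by (simp add: mult_ac)
  qed
  finally show ?thesis by (simp add: sum_distrib_left)
qed

text \<open>Here \<open>k - 2 * s = 1\<close>, so only \<open>bernoulli 0\<close> and
  \<open>bernoulli 1\<close> occur: the inner sum is \<open>i - (2 * K - 1) / 2\<close>.\<close>

lemma Fcoeff_last:
  assumes "K \<ge> 1"
  shows "Fcoeff (2 * K + 1) i K = (of_nat (2 * K + 1) - 2 - 2 * of_nat i) / (of_nat (2 * K + 1) - 2)"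
proof -
  obtain K' where K: "K = Suc K'" using assms by (cases K) auto
  have "(1 :: rat) + 2 * of_nat K' \<noteq> 0"
    by (metis of_nat_1 of_nat_add of_nat_mult of_nat_numeral of_nat_eq_0_iff add_is_0 one_neq_zero)
  then show ?thesis
    by (simp add: Fcoeff_def K bernoulli_0 bernoulli_1[simplified] field_simps)
qed

text \<open>The term added to \<open>F\<close> is the summand \<open>s = K\<close>, whose power of
  \<open>x\<close> is \<open>x ^ 0\<close>.\<close>

lemma F_bernsum:
  assumes "k = 2 * K + 1" and "K \<ge> 1"
  shows "x * (F k i x y + Const ((of_nat k - 2 - 2 * of_nat i) / (of_nat k - 2)) * y ^ (k - 2)) =
    bernsum (k - 2) i x (- y) - bernsum (k - 2) i x y"
proof -
  have "{1..K} = insert K {1..K - 1}" using assms by auto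
  then have "(\<Sum>s = 1..K. scalar (Fcoeff k i s) * x ^ (2 * K - 2 * s) * y ^ (2 * s - 1)) =
      F k i x y + scalar (Fcoeff k i K) * y ^ (k - 2)"
    using assms by (simp add: F_def Fcoeff_def scalar_def add.commute)
  moreover have "Suc (k - 2) = 2 * K" using assms by simp
  ultimately show ?thesis
    using bernsum_odd_part[of "k - 2" K i x y] Fcoeff_last[OF assms(2), of i] assms(1)
    by (simp add: scalar_def)
qed

section \<open>The identities for \<open>F\<close> and \<open>G\<close>\<close>

lemma F_identity:
  assumes k: "k = 2 * K + 1" and K: "K \<ge> 1" and i: "i \<le> k - 2"
  shows "F k i (X + Y) X + F k i (X + Y) Y = R k i X Y"
proof -
  define c where "c = Const ((of_nat k - 2 - 2 * of_nat i) / (of_nat k - 2))"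
  define x where "x = X"
  define y where "y = Y"
  define z where "z = x + y"
  define w where "w = k - 2"
  have "odd w" using k K by (auto simp: w_def)
  \<comment> \<open>As \<open>w\<close> is odd, \<open>w - i\<close> and \<open>i\<close> have
    opposite parity.\<close>
  then have sgn: "(- a) ^ (w - i) = - ((- 1) ^ i * a ^ (w - i))" for a :: "rat poly poly"
    using i by (auto simp: w_def power_minus[of a] minus_one_power_iff)
  have z0: "z \<noteq> 0" by (simp add: z_def x_def y_def)
  have "z * (F k i z x + c * x ^ w + (F k i z y + c * y ^ w)) =
      (bernsum w i z (- x) - bernsum w i z x) + (bernsum w i z (- y) - bernsum w i z y)"
    using F_bernsum[OF k K, of z i] by (simp only: distrib_left w_def c_def)
  \<comment> \<open>Since \<open>x = - y + z\<close> and \<open>y = - x + z\<close>, regrouping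
    across the two brackets pairs arguments that differ by \<open>z\<close>.\<close>
  also have "\<dots> = - (bernsum w i z (- y + z) - bernsum w i z (- y)) - (bernsum w i z (- x + z) - bernsum w i z (- x))"
    by (simp add: z_def)
  also have "\<dots> = - (z * (- y) ^ (w - i) * (z + - y) ^ i) - (z * (- x) ^ (w - i) * (z + - x) ^ i)"
    using i by (simp only: bernsum_diff w_def)
  also have "\<dots> = z * ((- 1) ^ i * x ^ (w - i) * y ^ i + (- 1) ^ i * x ^ i * y ^ (w - i))"
    by (simp add: sgn z_def algebra_simps)
  finally have "F k i z x + c * x ^ w + (F k i z y + c * y ^ w) =
      (- 1) ^ i * x ^ (w - i) * y ^ i + (- 1) ^ i * x ^ i * y ^ (w - i)"
    using z0 by simp
  then have "F k i z x + F k i z y = R k i x y"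
    unfolding R_def w_def[symmetric] c_def[symmetric] by (simp add: algebra_simps)
  then show ?thesis by (simp only: x_def y_def z_def)
qed

lemma G_eq_F: "G k i x y = - F k (k - 2 - i) x y"
  unfolding G_def F_def scalar_def[symmetric]
  by (simp add: scalar_minus sum_negf)

text \<open>With \<open>w = k - 2\<close> odd, \<open>w - 2 * (w - i) = - (w - 2 * i)\<close> and
  the sign \<open>(- 1) ^ i\<close> flips, while the two mixed monomials change places.\<close>

lemma R_reflect:
  assumes "odd k" and "k \<ge> 2" and "i \<le> k - 2"
  shows "R k (k - 2 - i) x y = - R k i x y"
proof -
  have "(of_nat k - 2 - 2 * of_nat (k - 2 - i)) / (of_nat k - 2) =
      - ((of_nat k - 2 - 2 * of_nat i) / (of_nat k - 2) :: rat)"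
    unfolding minus_divide_left using assms by (simp add: of_nat_diff)
  then have "Const ((of_nat k - 2 - 2 * of_nat (k - 2 - i)) / (of_nat k - 2)) =
      - Const ((of_nat k - 2 - 2 * of_nat i) / (of_nat k - 2))"
    by simp
  moreover have "(- 1) ^ (k - 2 - i) = (- ((- 1) ^ i) :: rat poly poly)"
    using assms by (auto simp: minus_one_power_iff)
  moreover have "k - 2 - (k - 2 - i) = i" using assms by simp
  ultimately show ?thesis unfolding R_def by (simp only:)
qed

theorem theorem2:
  fixes k K i :: nat
  assumes "k = 2 * K + 1" and "k \<ge> 5" and "i \<le> k - 2"
  shows "F k i (X + Y) X + F k i (X + Y) Y = R k i X Y \<and>
         G k i (X + Y) X + G k i (X + Y) Y = R k i X Y"
proof
  have K: "K \<ge> 1" using assms by simp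
  show "F k i (X + Y) X + F k i (X + Y) Y = R k i X Y"
    using F_identity assms K by blast
  have "G k i (X + Y) X + G k i (X + Y) Y = - (F k (k - 2 - i) (X + Y) X + F k (k - 2 - i) (X + Y) Y)"
    by (simp only: G_eq_F minus_add_distrib)
  also have "\<dots> = - R k (k - 2 - i) X Y"
    using F_identity[OF assms(1) K, of "k - 2 - i"] by simp
  also have "\<dots> = R k i X Y"
    using R_reflect[of k i X Y] assms by simp
  finally show "G k i (X + Y) X + G k i (X + Y) Y = R k i X Y" .
qed

end
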